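(* Let $A=(a_{ij})$ and $B=(b_{ij})$ be integer $n\times n$ matrices with non-negative entries having matching row and column sums, i.e. $\sum_{i=1}^n a_{ij_0}=\sum_{i=1}^n b_{ij_0}$ and $\sum_{j=1}^n a_{i_0j}=\sum_{j=1}^n b_{i_0j}$ for all $1\le i_0,j_0\le n$. Then there exist swaps $\delta_1(\mathbf{u}_r,\mathbf{v}_r)$ for $r=1,\dots,t$ such that $$A=B+\sum_{r=1}^t\delta_1(\mathbf{u}_r,\mathbf{v}_r).$$ Moreover the swaps can be chosen such that $B+\sum_{r=1}^{t_0}\delta_1(\mathbf{u}_r,\mathbf{v}_r)$ has non-negative entries for all $1\le t_0\le t$.
   Context: Let $E_{ij}$ denote the standard basis matrices of $\mathbb{R}^{n\times n}$. For $a\in\mathbb{R}$ and index pairs $\mathbf{u}=(u_1,u_2)$, $\mathbf{v}=(v_1,v_2)$ (row index, column index), the swap $\delta_a(\mathbf{u},\mathbf{v})\in\mathbb{R}^{n\times n}$ is $\delta_a(\mathbf{u},\mathbf{v})=a(E_{u_1u_2}+E_{v_1v_2}-E_{v_1u_2}-E_{u_1v_2})$. *)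

theory Defs
  imports "HOL-Analysis.Analysis"
begin

definition basis_matrix :: "'n::finite \<Rightarrow> 'n \<Rightarrow> real^'n^'n" where
  "basis_matrix i j = axis i (axis j 1)"

text \<open>
  No condition is imposed on the index pairs: if they share a row or a column, the swap is the
  zero matrix.
\<close>

definition swap_matrix :: "real \<Rightarrow> 'n::finite \<times> 'n \<Rightarrow> 'n \<times> 'n \<Rightarrow> real^'n^'n" where
  "swap_matrix a u v =
     a *\<^sub>R (basis_matrix (fst u) (snd u) + basis_matrix (fst v) (snd v)
          - basis_matrix (fst v) (snd u) - basis_matrix (fst u) (snd v))"

end

theory Submission
  imports Defs
begin

text \<open>
  The swaps are found greedily, each one bringing the current matrix strictly closer to \<open>A\<close> in the
  entrywise \<open>l1\<close> distance. If \<open>A \<noteq> B\<close>, then equality of the row sums yields an entry \<open>(i, j)\<close> with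
  \<open>A\<^sub>i\<^sub>j > B\<^sub>i\<^sub>j\<close>. Row \<open>i\<close> and column \<open>j\<close> have the same sums in both matrices, so the excess is
  compensated by entries \<open>(i, k)\<close> and \<open>(l, j)\<close> where \<open>B\<close> exceeds \<open>A\<close>. The swap that adds 1 at
  \<open>(i, j)\<close> and \<open>(l, k)\<close> and subtracts 1 at \<open>(i, k)\<close> and \<open>(l, j)\<close> then moves three entries one unit
  closer to their targets, by integrality, and moves at most the entry \<open>(l, k)\<close> one unit away; so
  the distance drops by at least 2 (lemma \<open>ex_closer_swap\<close>). The two entries that are decreased are
  larger than entries of \<open>A\<close>, hence positive integers, so nonnegativity is preserved. Swaps
  preserve row and column sums and integrality, so the step can be repeated until \<open>A\<close> is reached.
\<close>

lemma swap_matrix_nth: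
  "swap_matrix 1 (i, j) (l, k) $ p $ q =
     (of_bool (p = i) - of_bool (p = l)) * (of_bool (q = j) - of_bool (q = k))"
  by (auto simp: swap_matrix_def basis_matrix_def axis_def)

lemma swap_matrix_row_sum: "(\<Sum>q\<in>UNIV. swap_matrix 1 u v $ p $ q) = 0"
  by (cases u; cases v)
    (simp add: swap_matrix_nth sum_subtractf of_bool_def flip: sum_distrib_left)

lemma swap_matrix_column_sum: "(\<Sum>p\<in>UNIV. swap_matrix 1 u v $ p $ q) = 0"
  by (cases u; cases v)
    (simp add: swap_matrix_nth sum_subtractf of_bool_def flip: sum_distrib_right)

lemma swap_matrix_Ints: "swap_matrix 1 u v $ p $ q \<in> \<int>"
  by (cases u; cases v) (simp add: swap_matrix_nth)

lemma sum_eq_imp_ex_less: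
  fixes f g :: "'a \<Rightarrow> real"
  assumes "finite S" "sum f S = sum g S" "x \<in> S" "f x < g x"
  shows "\<exists>y\<in>S. g y < f y"
proof (rule ccontr)
  assume "\<not> ?thesis"
  then have "sum f S < sum g S"
    using assms by (intro sum_strict_mono_ex1) (auto simp: not_less)
  then show False using assms(2) by simp
qed

definition entry_dist :: "real^'n::finite^'m::finite \<Rightarrow> real^'n^'m \<Rightarrow> real" where
  "entry_dist A B = (\<Sum>i\<in>UNIV. \<Sum>j\<in>UNIV. \<bar>A $ i $ j - B $ i $ j\<bar>)"

lemma entry_dist_nonpos_imp_eq:
  assumes "entry_dist A B \<le> 0"
  shows "A = B"
proof -
  have "entry_dist A B = 0"
    using assms unfolding entry_dist_def by (intro antisym sum_nonneg) auto
  then show ?thesis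
    by (simp add: entry_dist_def sum_nonneg_eq_0_iff sum_nonneg vec_eq_iff)
qed

text \<open>
  The row and column sums locate three corners of a rectangle at which the swap corrects \<open>B\<close> in
  the right direction; whatever happens at the fourth corner costs at most one of the three units
  gained.
\<close>

lemma ex_closer_swap:
  fixes A B :: "real^'n::finite^'n"
  assumes A_int: "\<And>i j. A $ i $ j \<in> \<int>" and B_int: "\<And>i j. B $ i $ j \<in> \<int>"
    and A_nonneg: "\<And>i j. A $ i $ j \<ge> 0" and B_nonneg: "\<And>i j. B $ i $ j \<ge> 0"
    and cols: "\<And>j. (\<Sum>i\<in>UNIV. A $ i $ j) = (\<Sum>i\<in>UNIV. B $ i $ j)"
    and rows: "\<And>i. (\<Sum>j\<in>UNIV. A $ i $ j) = (\<Sum>j\<in>UNIV. B $ i $ j)"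
    and "A \<noteq> B"
  obtains u v where "\<And>i j. (B + swap_matrix 1 u v) $ i $ j \<ge> 0"
    and "entry_dist A (B + swap_matrix 1 u v) \<le> entry_dist A B - 2"
proof -
  have gap: "x + 1 \<le> y" if "x \<in> \<int>" "y \<in> \<int>" "x < y" for x y :: real
    using that by (auto elim!: Ints_cases)
  obtain p q where "A $ p $ q \<noteq> B $ p $ q"
    using \<open>A \<noteq> B\<close> by (auto simp: vec_eq_iff)
  then obtain i j where ij: "B $ i $ j < A $ i $ j"
    using sum_eq_imp_ex_less[OF finite rows[of p]] by (meson UNIV_I linorder_neqE)
  obtain k where ik: "A $ i $ k < B $ i $ k"
    using sum_eq_imp_ex_less[OF finite rows[of i, symmetric]] ij by blast
  obtain l where lj: "A $ l $ j < B $ l $ j"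
    using sum_eq_imp_ex_less[OF finite cols[of j, symmetric]] ij by blast
  have ne: "i \<noteq> l" "j \<noteq> k"
    using ij ik lj by auto
  define S where "S = swap_matrix 1 (i, j) (l, k)"
  note gaps = gap[OF B_int A_int ij] gap[OF A_int B_int ik] gap[OF A_int B_int lj]
  have nonneg: "(B + S) $ p $ q \<ge> 0" for p q
    using gaps B_nonneg[of p q] A_nonneg[of i k] A_nonneg[of l j] ne
    by (auto simp: S_def swap_matrix_nth of_bool_def)
  (* c bounds the change of each entry's distance: -1 at the three good corners, +1 at (l, k). *)
  define c :: "'n \<Rightarrow> 'n \<Rightarrow> real" where
    "c p q = of_bool (p = l) * (of_bool (q = k) - of_bool (q = j))
             - of_bool (p = i) * (of_bool (q = j) + of_bool (q = k))" for p q
  have "\<bar>A $ p $ q - (B + S) $ p $ q\<bar> \<le> \<bar>A $ p $ q - B $ p $ q\<bar> + c p q" for p q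
    using gaps ne by (auto simp: S_def swap_matrix_nth c_def of_bool_def)
  then have "entry_dist A (B + S) \<le>
      (\<Sum>p\<in>UNIV. \<Sum>q\<in>UNIV. \<bar>A $ p $ q - B $ p $ q\<bar> + c p q)"
    unfolding entry_dist_def by (intro sum_mono)
  also have "\<dots> = entry_dist A B + (\<Sum>p\<in>UNIV. \<Sum>q\<in>UNIV. c p q)"
    by (simp add: entry_dist_def sum.distrib)
  also have "(\<Sum>p\<in>UNIV. \<Sum>q\<in>UNIV. c p q) = -2"
    by (simp add: c_def sum_subtractf sum.distrib sum_negf of_bool_def
        flip: sum_distrib_left sum_distrib_right)
  finally show ?thesis
    using that[of "(i, j)" "(l, k)"] nonneg by (simp add: S_def)
qed

theorem proposition6p4:
  fixes A B :: "real^'n::finite^'n"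
  assumes A_int: "\<And>i j. A $ i $ j \<in> \<int>" and B_int: "\<And>i j. B $ i $ j \<in> \<int>"
    and A_nonneg: "\<And>i j. A $ i $ j \<ge> 0" and B_nonneg: "\<And>i j. B $ i $ j \<ge> 0"
    and column_sums: "\<And>j\<^sub>0. (\<Sum>i\<in>UNIV. A $ i $ j\<^sub>0) = (\<Sum>i\<in>UNIV. B $ i $ j\<^sub>0)"
    and row_sums: "\<And>i\<^sub>0. (\<Sum>j\<in>UNIV. A $ i\<^sub>0 $ j) = (\<Sum>j\<in>UNIV. B $ i\<^sub>0 $ j)"
  shows "\<exists>(t::nat) (u :: nat \<Rightarrow> 'n \<times> 'n) (v :: nat \<Rightarrow> 'n \<times> 'n).
           A = B + (\<Sum>r=1..t. swap_matrix 1 (u r) (v r)) \<and>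
           (\<forall>t\<^sub>0\<in>{1..t}. \<forall>i j. (B + (\<Sum>r=1..t\<^sub>0. swap_matrix 1 (u r) (v r))) $ i $ j \<ge> 0)"
proof -
  obtain N :: nat where "entry_dist A B \<le> real N"
    using real_arch_simple by blast
  then show ?thesis
    using B_int B_nonneg column_sums row_sums
  proof (induction N arbitrary: B)
    case 0
    then have "A = B"
      by (intro entry_dist_nonpos_imp_eq) simp
    then show ?case
      by (intro exI[of _ 0]) simp
  next
    case (Suc N)
    show ?case
    proof (cases "A = B")
      case True
      then show ?thesis
        by (intro exI[of _ 0]) simp
    next
      case False
      obtain u0 v0 where nonneg: "\<And>i j. (B + swap_matrix 1 u0 v0) $ i $ j \<ge> 0"
        and closer: "entry_dist A (B + swap_matrix 1 u0 v0) \<le> entry_dist A B - 2"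
        using ex_closer_swap[OF A_int Suc.prems(2) A_nonneg Suc.prems(3-5) False] by blast
      define C where "C = B + swap_matrix 1 u0 v0"
      have "entry_dist A C \<le> real N"
        using closer Suc.prems(1) by (simp add: C_def)
      moreover have "C $ i $ j \<in> \<int>" for i j
        using Suc.prems(2) swap_matrix_Ints by (simp add: C_def)
      moreover have "C $ i $ j \<ge> 0" for i j
        using nonneg by (simp add: C_def)
      moreover have "(\<Sum>i\<in>UNIV. A $ i $ j) = (\<Sum>i\<in>UNIV. C $ i $ j)" for j
        using Suc.prems(4) by (simp add: C_def sum.distrib swap_matrix_column_sum)
      moreover have "(\<Sum>j\<in>UNIV. A $ i $ j) = (\<Sum>j\<in>UNIV. C $ i $ j)" for i
        using Suc.prems(5) by (simp add: C_def sum.distrib swap_matrix_row_sum)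
      ultimately have "\<exists>(t::nat) (u :: nat \<Rightarrow> 'n \<times> 'n) (v :: nat \<Rightarrow> 'n \<times> 'n).
          A = C + (\<Sum>r=1..t. swap_matrix 1 (u r) (v r)) \<and>
          (\<forall>s\<in>{1..t}. \<forall>i j. (C + (\<Sum>r=1..s. swap_matrix 1 (u r) (v r))) $ i $ j \<ge> 0)"
        by (rule Suc.IH)
      then obtain t :: nat and u v where A_eq: "A = C + (\<Sum>r=1..t. swap_matrix 1 (u r) (v r))"
        and uv: "\<forall>s\<in>{1..t}. \<forall>i j. (C + (\<Sum>r=1..s. swap_matrix 1 (u r) (v r))) $ i $ j \<ge> 0"
        by blast
      define u' where "u' r = (if r = 1 then u0 else u (r - 1))" for r
      define v' where "v' r = (if r = 1 then v0 else v (r - 1))" for r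
      have shift: "B + (\<Sum>r=1..Suc s. swap_matrix 1 (u' r) (v' r)) =
          C + (\<Sum>r=1..s. swap_matrix 1 (u r) (v r))" for s
      proof -
        have "(\<Sum>r=1..Suc s. swap_matrix 1 (u' r) (v' r)) =
            swap_matrix 1 (u' 1) (v' 1) + (\<Sum>r=1..s. swap_matrix 1 (u' (Suc r)) (v' (Suc r)))"
          by (subst sum.atLeast_Suc_atMost) (simp_all add: sum.atLeast_Suc_atMost_Suc_shift del: sum.cl_ivl_Suc)
        also have "(\<Sum>r=1..s. swap_matrix 1 (u' (Suc r)) (v' (Suc r))) =
            (\<Sum>r=1..s. swap_matrix 1 (u r) (v r))"
          by (intro sum.cong) (auto simp: u'_def v'_def)
        finally show ?thesis
          by (simp add: C_def u'_def v'_def add.assoc)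
      qed
      have "(B + (\<Sum>r=1..s. swap_matrix 1 (u' r) (v' r))) $ i $ j \<ge> 0" if "s \<in> {1..Suc t}" for s i j
      proof -
        obtain s' where s': "s = Suc s'" "s' \<le> t"
          using \<open>s \<in> {1..Suc t}\<close> by (cases s) auto
        have "(C + (\<Sum>r=1..s'. swap_matrix 1 (u r) (v r))) $ i $ j \<ge> 0"
        proof (cases "s' = 0")
          case True
          then show ?thesis using nonneg[of i j] by (simp add: C_def)
        next
          case False
          then show ?thesis using uv s'(2) by simp
        qed
        then show ?thesis
          using shift[of s'] s'(1) by metis
      qed
      moreover have "A = B + (\<Sum>r=1..Suc t. swap_matrix 1 (u' r) (v' r))"
        using A_eq shift[of t] by metis
      ultimately show ?thesis
        by blast
    qed
  qed
qed

end
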